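(* The expected value of the main-lobe RFI brightness temperature $T_{(ml)}$ is $$\mathbb{E}[T_{(ml)}]=40^2\,g_{(ml)}\,\omega\,\lambda_c\,p_{1}(\lambda_{BS})\,d_{(ml)}^{-\alpha},$$ where $p_1(\lambda_{BS})=(2b_0)\lambda_{BS}$ under Rayleigh fading, and $p_1(\lambda_{BS})=(2b_0)\lambda_{BS}\left(m\frac{2b_0m+\Omega}{2b_0m}-m+1\right)$ under shadowed Rician fading.
   Context: Constants $\omega>0$, $\alpha>2$, $\lambda_c>0$ (cluster intensity per km$^2$), $\lambda_{BS}>0$, $g_{(ml)}>0$, Earth radius $r_e>0$ and satellite distance to the Earth's center $h>r_e$ are given. $d_{(ml)}$ is the positive root $d$ of $d^2+2d\,r_e\cos(40^\circ)+r_e^2-h^2=0$. The main-lobe footprint has area $40^2$ km$^2$ and contains $M\sim\mathrm{Pois}(40^2\lambda_c)$ clusters, all at distance $d_{(ml)}$ from the satellite. $T_{(ml)}=\sum_{i=1}^{M}\sum_{j=1}^{N_i}g_{(ml)}\omega|H_{ij}|^2d_{(ml)}^{-\alpha}$, with $N_i\sim\mathrm{Pois}(\lambda_{BS})$ i.i.d., channel power gains $|H_{ij}|^2$ i.i.d., and all of $M$, $N_i$, $|H_{ij}|^2$ independent. Rayleigh fading: $|H|^2$ is exponential with mean $2b_0$. Shadowed Rician fading with parameters $(\Omega,2b_0,m)$, $b_0,m,\Omega>0$: $|H|^2$ has density $\frac{1}{2b_0}\left(\frac{2b_0m}{2b_0m+\Omega}\right)^m e^{-t/(2b_0)}\,{}_1F_1\left(m;1;\frac{\Omega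 t}{2b_0(2b_0m+\Omega)}\right)$ on $t>0$. *)

theory Defs
  imports "HOL-Probability.Probability"
begin

text \<open>Confluent hypergeometric function \<open>\<^sub>1F\<^sub>1(a; b; z)\<close>.\<close>

definition hyp1F1 :: "real \<Rightarrow> real \<Rightarrow> real \<Rightarrow> real" where
  "hyp1F1 a b z = eval_fps (fps_hypergeo [a] [b] 1) z"

lemma hyp1F1_series:
  "hyp1F1 a b z = (\<Sum>n. pochhammer a n / (pochhammer b n * fact n) * z ^ n)"
  by (simp add: hyp1F1_def eval_fps_def)

definition shadowed_rician_density :: "real \<Rightarrow> real \<Rightarrow> real \<Rightarrow> real \<Rightarrow> real" where
  "shadowed_rician_density \<Omega> b0 m t =
     (if t > 0 then
        1 / (2 * b0) * ((2 * b0 * m) / (2 * b0 * m + \<Omega>)) powr m * exp (- t / (2 * b0))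
          * hyp1F1 m 1 (\<Omega> * t / (2 * b0 * (2 * b0 * m + \<Omega>)))
      else 0)"

text \<open>
  Index set of all random inputs of the model: the number of clusters, the number of base
  stations in each cluster, and the channel power gain of each base station.
\<close>

datatype rv_index = Cluster_count | Station_count nat | Power_gain nat nat

text \<open>
  Joint independence needs a common value space, so the counts are embedded into the reals.
  This embedding does not change the generated sigma-algebras, since every subset of the
  naturals is the preimage of a Borel set.
\<close>

definition model_rv ::
  "('a \<Rightarrow> nat) \<Rightarrow> (nat \<Rightarrow> 'a \<Rightarrow> nat) \<Rightarrow> (nat \<Rightarrow> nat \<Rightarrow> 'a \<Rightarrow> complex) \<Rightarrow> rv_index \<Rightarrow> 'a \<Rightarrow> real" where
  "model_rv M N H k x =
     (case k of
        Cluster_count \<Rightarrow> real (M x)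
      | Station_count i \<Rightarrow> real (N i x)
      | Power_gain i j \<Rightarrow> (cmod (H i j x))\<^sup>2)"

text \<open>
  Clusters and base stations are numbered from 0, so \<open>i < M\<close> stands for \<open>1 \<le> i \<le> M\<close>.
\<close>

definition T_ml ::
  "real \<Rightarrow> real \<Rightarrow> real \<Rightarrow> real \<Rightarrow> ('a \<Rightarrow> nat) \<Rightarrow> (nat \<Rightarrow> 'a \<Rightarrow> nat) \<Rightarrow> (nat \<Rightarrow> nat \<Rightarrow> 'a \<Rightarrow> complex)
    \<Rightarrow> 'a \<Rightarrow> real" where
  "T_ml g \<omega> \<alpha> d M N H x =
     (\<Sum>i<M x. \<Sum>j<N i x. g * \<omega> * (cmod (H i j x))\<^sup>2 * d powr (- \<alpha>))"

end

theory Submission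
  imports Defs "HOL-Analysis.Generalised_Binomial_Theorem"
begin

text \<open>
  The mean factorizes as in Wald's identity: summing \<open>P(i < M) P(j < N\<^sub>i) E|H\<^sub>i\<^sub>j|\<^sup>2\<close> over all \<open>i\<close> and \<open>j\<close>,
  with all terms nonnegative, gives \<open>E M \<cdot> E N \<cdot> E|H|\<^sup>2\<close>. For the shadowed Rician gain, integrating
  the hypergeometric series termwise against the exponential density produces
  \<open>\<beta> (1 - w)\<^sup>m \<Sum>\<^sub>n (n + 1) (m)\<^sub>n w\<^sup>n / n!\<close> with \<open>\<beta> = 2 b\<^sub>0\<close> and \<open>w = \<Omega> / (\<beta> m + \<Omega>)\<close>, which the binomial series
  evaluates to \<open>\<beta> + \<Omega>\<close>.
\<close>

section \<open>Mean of a Poisson count\<close>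

lemma nn_integral_poisson_mean:
  assumes "0 < r" and D: "distributed P (count_space UNIV) X (\<lambda>k. ennreal (pmf (poisson_pmf r) k))"
  shows "(\<integral>\<^sup>+x. ennreal (real (X x)) \<partial>P) = ennreal r"
proof -
  have "(\<integral>\<^sup>+x. ennreal (real (X x)) \<partial>P)
      = (\<integral>\<^sup>+k. ennreal (pmf (poisson_pmf r) k) * ennreal (real k) \<partial>count_space UNIV)"
    by (rule distributed_nn_integral[OF D, symmetric]) simp
  also have "\<dots> = (\<Sum>k. ennreal (pmf (poisson_pmf r) k * real k))"
    by (simp add: nn_integral_count_space_nat ennreal_mult del: pmf_poisson)
  also have "\<dots> = ennreal r"
  proof (rule suminf_ennreal_eq)
    show "0 \<le> pmf (poisson_pmf r) k * real k" for k
      by simp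
    \<comment> \<open>The term at \<open>k = 0\<close> vanishes, and
      \<open>(k + 1) / (k + 1)! = 1 / k!\<close> turns the shifted series into
      \<open>r * exp (- r)\<close> times the exponential series.\<close>
    have "(\<lambda>k. r * exp (- r) * (r ^ k /\<^sub>R fact k)) sums (r * exp (- r) * exp r)"
      by (intro sums_mult exp_converges)
    also have "r * exp (- r) * exp r = r"
      by (simp add: exp_minus)
    also have "(\<lambda>k. r * exp (- r) * (r ^ k /\<^sub>R fact k))
        = (\<lambda>k. pmf (poisson_pmf r) (Suc k) * real (Suc k))"
      using \<open>0 < r\<close> by (simp add: field_simps del: of_nat_Suc)
    finally show "(\<lambda>k. pmf (poisson_pmf r) k * real k) sums r"
      using sums_Suc_iff[of "\<lambda>k. pmf (poisson_pmf r) k * real k" r] by simp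
  qed
  finally show ?thesis .
qed

section \<open>Expectation of sums with random limits\<close>

lemma suminf_indicator_less: "(\<Sum>i. if i < n then f i else 0) = (\<Sum>i<n. f i :: ennreal)"
  using sums_If_finite_set[of "{..<n}" f] by (simp add: sums_iff)

text \<open>\<open>X\<close> is the sum over \<open>i\<close> of the indicators of
  \<open>i < X\<close>, and monotone convergence interchanges this sum with the integral. It later
  turns the sums of \<open>P(i < M)\<close> and \<open>P(j < N i)\<close> into means.\<close>

lemma nn_integral_nat_tail_sum:
  fixes X :: "'a \<Rightarrow> nat"
  assumes X [measurable]: "(\<lambda>x. real (X x)) \<in> borel_measurable P"
  shows "(\<Sum>i. \<integral>\<^sup>+x. (if i < X x then 1 else 0) \<partial>P) = (\<integral>\<^sup>+x. ennreal (real (X x)) \<partial>P)"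
proof -
  have m: "(\<lambda>x. if i < X x then 1 else 0 :: ennreal) \<in> borel_measurable P" for i
  proof -
    have "(\<lambda>x. if real i < real (X x) then 1 else 0 :: ennreal) \<in> borel_measurable P"
      by measurable
    then show ?thesis by simp
  qed
  have "(\<Sum>i. \<integral>\<^sup>+x. (if i < X x then 1 else 0) \<partial>P)
      = (\<integral>\<^sup>+x. (\<Sum>i. if i < X x then 1 else 0) \<partial>P)"
    by (rule nn_integral_suminf[OF m, symmetric])
  then show ?thesis
    by (simp add: suminf_indicator_less ennreal_of_nat_eq_real_of_nat)
qed

text \<open>Only the means of the counts and of the gain enter, so both fading laws are covered by
  choosing \<open>c\<close>.\<close>

lemma expectation_T_ml:
  fixes M :: "'a \<Rightarrow> nat" and N :: "nat \<Rightarrow> 'a \<Rightarrow> nat" and H :: "nat \<Rightarrow> nat \<Rightarrow> 'a \<Rightarrow> complex"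
  assumes "prob_space P"
    and indep: "prob_space.indep_vars P (\<lambda>_. borel) (model_rv M N H) UNIV"
    and pos: "0 \<le> g" "0 \<le> \<omega>" "0 \<le> a" "0 \<le> b" "0 \<le> c"
    and EM: "(\<integral>\<^sup>+x. ennreal (real (M x)) \<partial>P) = ennreal a"
    and EN: "\<And>i. (\<integral>\<^sup>+x. ennreal (real (N i x)) \<partial>P) = ennreal b"
    and EG: "\<And>i j. (\<integral>\<^sup>+x. ennreal ((cmod (H i j x))\<^sup>2) \<partial>P) = ennreal c"
  shows "integrable P (T_ml g \<omega> \<alpha> d M N H)"
    and "prob_space.expectation P (T_ml g \<omega> \<alpha> d M N H) = g * \<omega> * d powr (- \<alpha>) * (a * b * c)"
proof -
  interpret prob_space P by fact
  have rv: "model_rv M N H k \<in> borel_measurable P" for k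
    using indep by (simp add: indep_vars_def)
  have mM [measurable]: "(\<lambda>x. real (M x)) \<in> borel_measurable P"
    using rv[of Cluster_count] by (simp add: model_rv_def[abs_def])
  have mN [measurable]: "(\<lambda>x. real (N i x)) \<in> borel_measurable P" for i
    using rv[of "Station_count i"] by (simp add: model_rv_def[abs_def])
  have mG [measurable]: "(\<lambda>x. (cmod (H i j x))\<^sup>2) \<in> borel_measurable P" for i j
    using rv[of "Power_gain i j"] by (simp add: model_rv_def[abs_def])
  define t where "t = g * \<omega> * d powr (- \<alpha>)"
  have t: "0 \<le> t"
    using pos by (simp add: t_def)
  \<comment> \<open>Indicators of \<open>i < M\<close> and \<open>j < N i\<close>, compared in the
    reals so that they are Borel functions of the values of \<open>model_rv\<close>.\<close>
  define u :: "nat \<Rightarrow> 'a \<Rightarrow> ennreal" where "u i x = (if real i < real (M x) then 1 else 0)" for i x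
  define v :: "nat \<Rightarrow> nat \<Rightarrow> 'a \<Rightarrow> ennreal"
    where "v i j x = (if real j < real (N i x) then 1 else 0)" for i j x
  define w where "w i j x = ennreal ((cmod (H i j x))\<^sup>2)" for i j x
  have [measurable]: "u i \<in> borel_measurable P" for i
    unfolding u_def[abs_def] by measurable
  have [measurable]: "v i j \<in> borel_measurable P" for i j
    unfolding v_def[abs_def] by measurable
  have [measurable]: "w i j \<in> borel_measurable P" for i j
    unfolding w_def[abs_def] by measurable
  have prod: "(\<integral>\<^sup>+x. u i x * (v i j x * w i j x) \<partial>P)
      = (\<integral>\<^sup>+x. u i x \<partial>P) * ((\<integral>\<^sup>+x. v i j x \<partial>P) * ennreal c)" for i j
  proof -
    \<comment> \<open>The three factors depend on three distinct members of the independent family,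
      so the integral of their product factorizes. \<open>?I\<close> has one index of each kind,
      hence \<open>Y\<close> can ignore the constructor arguments.\<close>
    let ?I = "{Cluster_count, Station_count i, Power_gain i j}"
    define Y :: "rv_index \<Rightarrow> real \<Rightarrow> ennreal" where
      "Y k r = (case k of Cluster_count \<Rightarrow> if real i < r then 1 else 0
                | Station_count _ \<Rightarrow> if real j < r then 1 else 0
                | Power_gain _ _ \<Rightarrow> ennreal r)" for k r
    have Y: "Y k \<in> borel_measurable borel" for k
      unfolding Y_def[abs_def] by (cases k) simp_all
    have "indep_vars (\<lambda>_. borel) (\<lambda>k x. Y k (model_rv M N H k x)) ?I"
      by (rule indep_vars_compose2[OF indep_vars_subset[OF indep] Y]) simp
    then have "(\<integral>\<^sup>+x. (\<Prod>k\<in>?I. Y k (model_rv M N H k x)) \<partial>P)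
        = (\<Prod>k\<in>?I. \<integral>\<^sup>+x. Y k (model_rv M N H k x) \<partial>P)"
      by (intro indep_vars_nn_integral) auto
    moreover have "(\<integral>\<^sup>+x. w i j x \<partial>P) = ennreal c"
      by (simp add: w_def EG)
    ultimately show ?thesis
      by (simp add: Y_def model_rv_def u_def v_def w_def)
  qed
  have T: "ennreal (T_ml g \<omega> \<alpha> d M N H x) = ennreal t * (\<Sum>i. \<Sum>j. u i x * (v i j x * w i j x))" for x
  proof -
    \<comment> \<open>Indicators replace the random limits, so the series has a deterministic index
      range and can be integrated termwise.\<close>
    have "(\<Sum>i. \<Sum>j. u i x * (v i j x * w i j x))
        = (\<Sum>i. if i < M x then (\<Sum>j. if j < N i x then w i j x else 0) else 0)"
      by (intro suminf_cong) (auto simp: u_def v_def intro!: suminf_cong)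
    also have "\<dots> = (\<Sum>i<M x. \<Sum>j<N i x. w i j x)"
      by (simp add: suminf_indicator_less)
    also have "\<dots> = ennreal (\<Sum>i<M x. \<Sum>j<N i x. (cmod (H i j x))\<^sup>2)"
      by (simp add: w_def sum_ennreal sum_nonneg)
    also have "ennreal t * \<dots> = ennreal (t * (\<Sum>i<M x. \<Sum>j<N i x. (cmod (H i j x))\<^sup>2))"
      using t by (simp add: ennreal_mult sum_nonneg)
    also have "t * (\<Sum>i<M x. \<Sum>j<N i x. (cmod (H i j x))\<^sup>2) = T_ml g \<omega> \<alpha> d M N H x"
      by (simp add: T_ml_def t_def sum_distrib_left mult_ac)
    finally show ?thesis ..
  qed
  have tailN: "(\<Sum>j. \<integral>\<^sup>+x. v i j x \<partial>P) = ennreal b" for i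
    using nn_integral_nat_tail_sum[OF mN, of i] EN[of i] by (simp add: v_def)
  have tailM: "(\<Sum>i. \<integral>\<^sup>+x. u i x \<partial>P) = ennreal a"
    using nn_integral_nat_tail_sum[OF mM] EM by (simp add: u_def)
  have "(\<integral>\<^sup>+x. ennreal (T_ml g \<omega> \<alpha> d M N H x) \<partial>P)
      = ennreal t * (\<integral>\<^sup>+x. (\<Sum>i. \<Sum>j. u i x * (v i j x * w i j x)) \<partial>P)"
    unfolding T by (rule nn_integral_cmult) measurable
  also have "(\<integral>\<^sup>+x. (\<Sum>i. \<Sum>j. u i x * (v i j x * w i j x)) \<partial>P)
      = (\<Sum>i. \<Sum>j. \<integral>\<^sup>+x. u i x * (v i j x * w i j x) \<partial>P)"
    by (subst nn_integral_suminf, measurable)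
      (intro suminf_cong nn_integral_suminf, measurable)
  \<comment> \<open>The inner sum over \<open>j\<close> yields \<open>b * c\<close> for every
    \<open>i\<close>; the sum over \<open>i\<close> then yields \<open>a\<close>.\<close>
  also have "\<dots> = ennreal a * (ennreal b * ennreal c)"
    by (simp add: prod tailN tailM)
  finally have nn: "(\<integral>\<^sup>+x. ennreal (T_ml g \<omega> \<alpha> d M N H x) \<partial>P) = ennreal (t * (a * b * c))"
    using t pos by (simp add: ennreal_mult mult.assoc)
  have T0: "0 \<le> T_ml g \<omega> \<alpha> d M N H x" for x
    using pos by (simp add: T_ml_def sum_nonneg)
  \<comment> \<open>Measurability comes from the series \<open>T\<close>; nonnegativity undoes the
    passage through \<open>ennreal\<close>.\<close>
  have "(\<lambda>x. enn2real (ennreal (T_ml g \<omega> \<alpha> d M N H x))) \<in> borel_measurable P"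
    unfolding T by measurable
  then have mT: "T_ml g \<omega> \<alpha> d M N H \<in> borel_measurable P"
    using T0 by simp
  have bochner: "has_bochner_integral P (T_ml g \<omega> \<alpha> d M N H) (t * (a * b * c))"
    using mT T0 t pos nn by (intro has_bochner_integral_nn_integral) auto
  show "integrable P (T_ml g \<omega> \<alpha> d M N H)"
    using bochner by (rule integrable.intros)
  show "expectation (T_ml g \<omega> \<alpha> d M N H) = g * \<omega> * d powr (- \<alpha>) * (a * b * c)"
    using bochner by (simp add: has_bochner_integral_integral_eq t_def)
qed

section \<open>Mean power gain under Rayleigh and shadowed Rician fading\<close>

lemma nn_integral_exponential_mean:
  assumes "0 < \<beta>" and D: "distributed P lborel X (\<lambda>t. ennreal (exponential_density (1 / \<beta>) t))"
  shows "(\<integral>\<^sup>+x. ennreal (X x) \<partial>P) = ennreal \<beta>"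
proof -
  have "(\<integral>\<^sup>+x. ennreal (X x) \<partial>P)
      = (\<integral>\<^sup>+t. ennreal (exponential_density (1 / \<beta>) t) * ennreal t \<partial>lborel)"
    by (rule distributed_nn_integral[OF D, symmetric]) simp
  also have "\<dots> = (\<integral>\<^sup>+t. ennreal (exponential_density (1 / \<beta>) t * t ^ 1) \<partial>lborel)"
    using \<open>0 < \<beta>\<close> by (simp add: ennreal_mult')
  also have "\<dots> = ennreal \<beta>"
    using \<open>0 < \<beta>\<close> by (subst nn_integral_erlang_ith_moment) (auto simp: divide_ennreal)
  finally show ?thesis .
qed

text \<open>The generalised binomial series at \<open>- w\<close> with exponent \<open>- m\<close>:
  the sign \<open>(-1)^n\<close> of the binomial coefficient cancels that of
  \<open>(- w) ^ n\<close>.\<close>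

lemma sums_negative_binomial:
  fixes m w :: real
  assumes "\<bar>w\<bar> < 1"
  shows "(\<lambda>n. pochhammer m n / fact n * w ^ n) sums (1 - w) powr (- m)"
proof -
  have "((- m) gchoose n) * (- w) ^ n = pochhammer m n / fact n * w ^ n" for n
    by (cases "even n") (simp_all add: gbinomial_pochhammer)
  then show ?thesis
    using gen_binomial_real[of "- w" "- m"] assms by simp
qed

text \<open>Split the weight into \<open>n\<close> and \<open>1\<close>. After an index shift,
  \<open>pochhammer m (Suc n) = m * pochhammer (m + 1) n\<close> makes the first part
  \<open>m * w\<close> times the binomial series for \<open>m + 1\<close>.\<close>

lemma sums_negative_binomial_moment:
  fixes m w :: real
  assumes "\<bar>w\<bar> < 1"
  shows "(\<lambda>n. real (Suc n) * (pochhammer m n / fact n * w ^ n))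
    sums ((1 - w) powr (- m) * (1 + m * w / (1 - w)))"
proof -
  have "(\<lambda>n. m * w * (pochhammer (m + 1) n / fact n * w ^ n)) sums (m * w * (1 - w) powr (- (m + 1)))"
    by (intro sums_mult sums_negative_binomial assms)
  also have "(\<lambda>n. m * w * (pochhammer (m + 1) n / fact n * w ^ n))
      = (\<lambda>n. real (Suc n) * (pochhammer m (Suc n) / fact (Suc n) * w ^ Suc n))"
    by (simp add: pochhammer_rec fun_eq_iff field_simps del: of_nat_Suc)
  finally have "(\<lambda>n. real n * (pochhammer m n / fact n * w ^ n)) sums (m * w * (1 - w) powr (- (m + 1)))"
    using sums_Suc_iff[of "\<lambda>n. real n * (pochhammer m n / fact n * w ^ n)"] by simp
  from sums_add[OF this sums_negative_binomial[OF assms, of m]]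
  have "(\<lambda>n. real (Suc n) * (pochhammer m n / fact n * w ^ n))
      sums (m * w * (1 - w) powr (- (m + 1)) + (1 - w) powr (- m))"
    by (simp only: of_nat_Suc distrib_right mult_1 add.commute)
  also have "(1 - w) powr (- (m + 1)) = (1 - w) powr (- m) / (1 - w)"
    using assms powr_diff[of "1 - w" "- m" 1] by simp
  also have "m * w * ((1 - w) powr (- m) / (1 - w)) + (1 - w) powr (- m)
      = (1 - w) powr (- m) * (1 + m * w / (1 - w))"
    by (simp add: algebra_simps)
  finally show ?thesis .
qed

text \<open>Convergence is the point: one factorial absorbs the Pochhammer symbol up to geometric
  growth, and the other leaves an exponential series as majorant.\<close>

lemma sums_hyp1F1_1:
  assumes "0 < m" "0 \<le> z"
  shows "(\<lambda>n. pochhammer m n / (fact n)\<^sup>2 * z ^ n) sums hyp1F1 m 1 z"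
proof -
  \<comment> \<open>\<open>K \<ge> m\<close> and \<open>K \<ge> 1\<close> give
    \<open>m + n \<le> K * (n + 1)\<close>, which bounds the ratio of consecutive
    coefficients.\<close>
  define K where "K = max 1 m"
  have K: "pochhammer m n / fact n \<le> K ^ n" for n
  proof (induction n)
    case (Suc n)
    have "m + real n \<le> K * real (Suc n)"
      using mult_right_mono[of 1 K "real n"] by (simp add: K_def algebra_simps)
    then have "(m + real n) / real (Suc n) \<le> K"
      by (simp add: divide_le_eq)
    then have "pochhammer m n / fact n * ((m + real n) / real (Suc n)) \<le> K ^ n * K"
      using assms by (intro mult_mono Suc) (auto simp: K_def)
    then show ?case
      by (simp add: pochhammer_rec' field_simps)
  qed simp
  have "summable (\<lambda>n. pochhammer m n / (fact n)\<^sup>2 * z ^ n)"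
  proof (rule summable_comparison_test')
    show "summable (\<lambda>n. inverse (fact n) * (K * z) ^ n)"
      by (rule summable_exp)
    show "norm (pochhammer m n / (fact n)\<^sup>2 * z ^ n) \<le> inverse (fact n) * (K * z) ^ n" for n
    proof -
      have "pochhammer m n / fact n * (z ^ n / fact n) \<le> K ^ n * (z ^ n / fact n)"
        using assms by (intro mult_right_mono K) simp
      then show ?thesis
        using assms by (simp add: pochhammer_nonneg power2_eq_square power_mult_distrib divide_inverse mult_ac)
    qed
  qed
  then show ?thesis
    by (simp add: hyp1F1_series pochhammer_fact[symmetric] power2_eq_square sums_iff)
qed

lemma nn_integral_shadowed_rician_mean:
  assumes pos: "0 < b0" "0 < m" "0 < \<Omega>"
    and X: "distributed P lborel X (\<lambda>t. ennreal (shadowed_rician_density \<Omega> b0 m t))"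
  shows "(\<integral>\<^sup>+x. ennreal (X x) \<partial>P) = ennreal (2 * b0 + \<Omega>)"
proof -
  define \<beta> where "\<beta> = 2 * b0"
  define D where "D = \<beta> * m + \<Omega>"
  \<comment> \<open>\<open>q\<close> is the base of the power in the density and
    \<open>w / \<beta>\<close> the factor of \<open>t\<close> in the argument of
    \<open>hyp1F1\<close>. Thus \<open>s n\<close> is the coefficient of \<open>t ^ n\<close> once
    the exponential density of mean \<open>\<beta>\<close> is factored out.\<close>
  define q where "q = \<beta> * m / D"
  define w where "w = \<Omega> / D"
  define s where "s n = q powr m * (pochhammer m n / (fact n)\<^sup>2 * (w / \<beta>) ^ n)" for n
  have \<beta>: "0 < \<beta>"
    using pos by (simp add: \<beta>_def)
  have D: "0 < D"
    using pos \<beta> by (simp add: D_def add_pos_pos)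
  have q: "0 < q" and w: "0 < w"
    using pos \<beta> D by (simp_all add: q_def w_def)
  have qw: "1 - w = q"
    using D by (simp add: q_def w_def diff_divide_eq_iff eq_divide_eq) (simp add: D_def)
  then have w1: "w < 1"
    using q by simp
  have wq: "m * w / q = \<Omega> / \<beta>"
    using pos \<beta> D by (simp add: q_def w_def field_simps)
  have s: "0 \<le> s n" for n
    using pos w \<beta> by (simp add: s_def pochhammer_nonneg)
  have dens: "ennreal (shadowed_rician_density \<Omega> b0 m t) * ennreal t
      = (\<Sum>n. ennreal (s n) * ennreal (exponential_density (1 / \<beta>) t * t ^ Suc n))" for t
  proof (cases "t > 0")
    case True
    have "(\<lambda>n. q powr m * exponential_density (1 / \<beta>) t * t * (pochhammer m n / (fact n)\<^sup>2 * (w / \<beta> * t) ^ n))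
        sums (q powr m * exponential_density (1 / \<beta>) t * t * hyp1F1 m 1 (w / \<beta> * t))"
      using True pos w \<beta> by (intro sums_mult sums_hyp1F1_1) auto
    also have "(\<lambda>n. q powr m * exponential_density (1 / \<beta>) t * t * (pochhammer m n / (fact n)\<^sup>2 * (w / \<beta> * t) ^ n))
        = (\<lambda>n. s n * (exponential_density (1 / \<beta>) t * t ^ Suc n))"
      unfolding s_def by (simp only: power_mult_distrib power_Suc mult_ac)
    also have "q powr m * exponential_density (1 / \<beta>) t * t * hyp1F1 m 1 (w / \<beta> * t)
        = shadowed_rician_density \<Omega> b0 m t * t"
      using True
      by (simp add: shadowed_rician_density_def exponential_density_def q_def w_def D_def \<beta>_def mult_ac)
    finally have sums: "(\<lambda>n. s n * (exponential_density (1 / \<beta>) t * t ^ Suc n))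
        sums (shadowed_rician_density \<Omega> b0 m t * t)" .
    have "(\<Sum>n. ennreal (s n * (exponential_density (1 / \<beta>) t * t ^ Suc n)))
        = ennreal (shadowed_rician_density \<Omega> b0 m t * t)"
      using True \<beta> s by (intro suminf_ennreal_eq sums) auto
    then show ?thesis
      using True s by (simp add: ennreal_mult' ennreal_mult'' del: power_Suc)
  next
    case False
    \<comment> \<open>For negative \<open>t\<close> the exponential density vanishes; at
      \<open>t = 0\<close> it does not, but the factor \<open>t ^ Suc n\<close> does.\<close>
    then have zero: "exponential_density (1 / \<beta>) t * t ^ Suc n = 0" for n
      by (cases "t = 0") (auto simp: exponential_density_def)
    show ?thesis
      unfolding zero using False by (simp add: ennreal_neg)
  qed
  have "(\<integral>\<^sup>+x. ennreal (X x) \<partial>P)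
      = (\<integral>\<^sup>+t. ennreal (shadowed_rician_density \<Omega> b0 m t) * ennreal t \<partial>lborel)"
    by (rule distributed_nn_integral[OF X, symmetric]) simp
  also have "\<dots> = (\<Sum>n. \<integral>\<^sup>+t. ennreal (s n) * ennreal (exponential_density (1 / \<beta>) t * t ^ Suc n) \<partial>lborel)"
    unfolding dens by (intro nn_integral_suminf) measurable
  also have "\<dots> = (\<Sum>n. ennreal (s n * (fact (Suc n) * \<beta> ^ Suc n)))"
  proof (intro suminf_cong)
    fix n
    have "(\<integral>\<^sup>+t. ennreal (s n) * ennreal (exponential_density (1 / \<beta>) t * t ^ Suc n) \<partial>lborel)
        = ennreal (s n) * (\<integral>\<^sup>+t. ennreal (exponential_density (1 / \<beta>) t * t ^ Suc n) \<partial>lborel)"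
      by (rule nn_integral_cmult) measurable
    \<comment> \<open>The exponential density is the Erlang density of shape index 0, whose moment
      of order \<open>n + 1\<close> is needed.\<close>
    also have "(\<integral>\<^sup>+t. ennreal (exponential_density (1 / \<beta>) t * t ^ Suc n) \<partial>lborel)
        = ennreal (fact (0 + Suc n) / (fact 0 * (1 / \<beta>) ^ Suc n))"
      using \<beta> by (intro nn_integral_erlang_ith_moment) simp
    also have "fact (0 + Suc n) / (fact 0 * (1 / \<beta>) ^ Suc n) = fact (Suc n) * \<beta> ^ Suc n"
      by (simp add: power_one_over del: power_Suc fact_Suc)
    finally show "(\<integral>\<^sup>+t. ennreal (s n) * ennreal (exponential_density (1 / \<beta>) t * t ^ Suc n) \<partial>lborel)
        = ennreal (s n * (fact (Suc n) * \<beta> ^ Suc n))"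
      using s by (simp add: ennreal_mult' del: power_Suc fact_Suc)
  qed
  also have "\<dots> = ennreal (\<beta> + \<Omega>)"
  proof (rule suminf_ennreal_eq)
    show "0 \<le> s n * (fact (Suc n) * \<beta> ^ Suc n)" for n
      using s \<beta> by simp
    \<comment> \<open>In \<open>s n * (fact (Suc n) * \<beta> ^ Suc n)\<close> one
      \<open>fact n\<close> cancels and leaves the weight \<open>n + 1\<close>, while the powers of
      \<open>\<beta>\<close> reduce to a single factor.\<close>
    have "(\<lambda>n. q powr m * \<beta> * (real (Suc n) * (pochhammer m n / fact n * w ^ n)))
        sums (q powr m * \<beta> * ((1 - w) powr (- m) * (1 + m * w / (1 - w))))"
      using w w1 by (intro sums_mult sums_negative_binomial_moment) simp
    also have "(\<lambda>n. q powr m * \<beta> * (real (Suc n) * (pochhammer m n / fact n * w ^ n)))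
        = (\<lambda>n. s n * (fact (Suc n) * \<beta> ^ Suc n))"
      using \<beta> by (simp add: fun_eq_iff s_def power2_eq_square field_simps)
    \<comment> \<open>Since \<open>1 - w = q\<close>, the powers cancel, and
      \<open>m * w / q = \<Omega> / \<beta>\<close> leaves
      \<open>\<beta> * (1 + \<Omega> / \<beta>)\<close>.\<close>
    also have "q powr m * \<beta> * ((1 - w) powr (- m) * (1 + m * w / (1 - w))) = \<beta> + \<Omega>"
      using q \<beta> by (simp add: qw wq powr_minus field_simps)
    finally show "(\<lambda>n. s n * (fact (Suc n) * \<beta> ^ Suc n)) sums (\<beta> + \<Omega>)" .
  qed
  finally show ?thesis
    by (simp add: \<beta>_def)
qed

theorem corollary7:
  fixes P :: "'a measure"
    and \<omega> \<alpha> lam_c lam_BS g re h d b0 m \<Omega> :: real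
    and M :: "'a \<Rightarrow> nat"
    and N :: "nat \<Rightarrow> 'a \<Rightarrow> nat"
    and H :: "nat \<Rightarrow> nat \<Rightarrow> 'a \<Rightarrow> complex"
  assumes "prob_space P"
    and "\<omega> > 0" and "\<alpha> > 2" and "lam_c > 0" and "lam_BS > 0" and "g > 0"
    and "re > 0" and "h > re"
    and "d > 0" and "d\<^sup>2 + 2 * d * re * cos (40 * pi / 180) + re\<^sup>2 - h\<^sup>2 = 0"
    and "b0 > 0"
    and "distributed P (count_space UNIV) M (\<lambda>k. ennreal (pmf (poisson_pmf (40\<^sup>2 * lam_c)) k))"
    and "\<And>i. distributed P (count_space UNIV) (N i) (\<lambda>k. ennreal (pmf (poisson_pmf lam_BS) k))"
    and "prob_space.indep_vars P (\<lambda>_. borel) (model_rv M N H) UNIV"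
  shows
    "((\<forall>i j. distributed P lborel (\<lambda>x. (cmod (H i j x))\<^sup>2)
               (\<lambda>t. ennreal (exponential_density (1 / (2 * b0)) t)))
        \<longrightarrow> integrable P (T_ml g \<omega> \<alpha> d M N H) \<and>
            prob_space.expectation P (T_ml g \<omega> \<alpha> d M N H)
              = 40\<^sup>2 * g * \<omega> * lam_c * ((2 * b0) * lam_BS) * d powr (- \<alpha>))
     \<and> (m > 0 \<and> \<Omega> > 0 \<and>
        (\<forall>i j. distributed P lborel (\<lambda>x. (cmod (H i j x))\<^sup>2)
               (\<lambda>t. ennreal (shadowed_rician_density \<Omega> b0 m t)))
        \<longrightarrow> integrable P (T_ml g \<omega> \<alpha> d M N H) \<and>
            prob_space.expectation P (T_ml g \<omega> \<alpha> d M N H)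
              = 40\<^sup>2 * g * \<omega> * lam_c
                  * ((2 * b0) * lam_BS * (m * ((2 * b0 * m + \<Omega>) / (2 * b0 * m)) - m + 1))
                  * d powr (- \<alpha>))"
proof -
  let ?T = "T_ml g \<omega> \<alpha> d M N H"
  have EM: "(\<integral>\<^sup>+x. ennreal (real (M x)) \<partial>P) = ennreal (40\<^sup>2 * lam_c)"
    using assms by (intro nn_integral_poisson_mean) auto
  have EN: "(\<integral>\<^sup>+x. ennreal (real (N i x)) \<partial>P) = ennreal lam_BS" for i
    using assms by (intro nn_integral_poisson_mean) auto
  have T: "integrable P ?T \<and> prob_space.expectation P ?T = g * \<omega> * d powr (- \<alpha>) * (40\<^sup>2 * lam_c * lam_BS * c)"
    if "0 \<le> c" "\<And>i j. (\<integral>\<^sup>+x. ennreal ((cmod (H i j x))\<^sup>2) \<partial>P) = ennreal c" for c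
    using expectation_T_ml[OF assms(1,14) _ _ _ _ that(1) EM EN that(2)] assms by simp
  show ?thesis
  proof (intro conjI[of "_ \<longrightarrow> _"] impI, goal_cases)
    case 1
    then show ?case
      using T[of "2 * b0"] nn_integral_exponential_mean[of "2 * b0" P] assms(11) by (simp add: mult_ac)
  next
    case 2
    \<comment> \<open>The bracket equals \<open>1 + \<Omega> / (2 * b0)\<close>, so the stated
      factor is the mean gain computed above.\<close>
    then have "2 * b0 * (m * ((2 * b0 * m + \<Omega>) / (2 * b0 * m)) - m + 1) = 2 * b0 + \<Omega>"
      using assms(11) by (simp add: field_simps)
    then have *: "2 * b0 * lam_BS * (m * ((2 * b0 * m + \<Omega>) / (2 * b0 * m)) - m + 1) = lam_BS * (2 * b0 + \<Omega>)"
      by (metis mult.assoc mult.commute)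
    show ?case
      unfolding * using T[of "2 * b0 + \<Omega>"] nn_integral_shadowed_rician_mean[of b0 m \<Omega> P] 2 assms(11)
      by (simp add: mult_ac)
  qed
qed

end
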